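(* Let $\theta=(\theta_1,\theta_2,\theta_3)\in\Theta$ and let $$g(u_1,u_2;\theta)=\exp\bigl\{\theta_1(u_1-1)+\theta_2(u_2-1)+\theta_3(u_1-1)(u_2-1)\bigr\},\qquad (u_1,u_2)\in[0,1]^2 .$$ Then $g(\cdot,\cdot;\theta)$ is the only probability generating function $g(u_1,u_2)$ (of a random vector with values in $\mathbb{N}_0^2$) that satisfies the following system of partial differential equations on $[0,1]^2$: $$\frac{\partial g(u_1,1)}{\partial u_1}-\theta_1\, g(u_1,1)=0,$$ $$\frac{\partial g(1,u_2)}{\partial u_2}-\theta_2\, g(1,u_2)=0,$$ $$\frac{\partial^2 g(u_1,u_2)}{\partial u_1\,\partial u_2}-f(u_1,u_2;\theta)\, g(u_1,u_2)=0,$$ where $f(u_1,u_2;\theta)=\theta_3+\{\theta_2+\theta_3(u_1-1)\}\{\theta_1+\theta_3(u_2-1)\}$.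
   Context: $\mathbb{N}_0=\{0,1,2,\ldots\}$ and $\Theta=\{(\theta_1,\theta_2,\theta_3)\in\mathbb{R}^3:\ \theta_1>\theta_3,\ \theta_2>\theta_3,\ \theta_3>0\}$. The probability generating function (pgf) of a random vector $(X_1,X_2)$ with values in $\mathbb{N}_0^2$ is $g(u_1,u_2)=E(u_1^{X_1}u_2^{X_2})$, $(u_1,u_2)\in[0,1]^2$. The function $g(\cdot,\cdot;\theta)$ in the claim is the pgf of the bivariate Poisson distribution $BP(\theta)$, i.e. of $(Y_1+Y_3,\,Y_2+Y_3)$, where $Y_1,Y_2,Y_3$ are independent Poisson random variables with means $\theta_1-\theta_3$, $\theta_2-\theta_3$ and $\theta_3$, respectively. *)

theory Defs
  imports "HOL-Probability.Probability"
begin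

definition Theta :: "(real \<times> real \<times> real) set" where
  "Theta = {(\<theta>1, \<theta>2, \<theta>3). \<theta>1 > \<theta>3 \<and> \<theta>2 > \<theta>3 \<and> \<theta>3 > 0}"

text \<open>
  A random vector with values in \<open>nat \<times> nat\<close> enters only through its law,
  which is a \<open>(nat \<times> nat) pmf\<close>. Powers follow the convention \<open>0 ^ 0 = 1\<close>.
\<close>

definition pgf :: "(nat \<times> nat) pmf \<Rightarrow> real \<Rightarrow> real \<Rightarrow> real" where
  "pgf p u1 u2 = measure_pmf.expectation p (\<lambda>(x1, x2). u1 ^ x1 * u2 ^ x2)"

text \<open>A pgf is a function on the unit square; values of \<open>g\<close> elsewhere are irrelevant.\<close>

definition is_pgf :: "(real \<Rightarrow> real \<Rightarrow> real) \<Rightarrow> bool" where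
  "is_pgf g \<longleftrightarrow> (\<exists>p. \<forall>u1\<in>{0..1}. \<forall>u2\<in>{0..1}. g u1 u2 = pgf p u1 u2)"

definition gBP :: "real \<Rightarrow> real \<Rightarrow> real \<Rightarrow> real \<Rightarrow> real \<Rightarrow> real" where
  "gBP \<theta>1 \<theta>2 \<theta>3 u1 u2 =
     exp (\<theta>1 * (u1 - 1) + \<theta>2 * (u2 - 1) + \<theta>3 * (u1 - 1) * (u2 - 1))"

definition fBP :: "real \<Rightarrow> real \<Rightarrow> real \<Rightarrow> real \<Rightarrow> real \<Rightarrow> real" where
  "fBP \<theta>1 \<theta>2 \<theta>3 u1 u2 =
     \<theta>3 + (\<theta>2 + \<theta>3 * (u1 - 1)) * (\<theta>1 + \<theta>3 * (u2 - 1))"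

text \<open>
  \<open>h\<close> is the mixed derivative of \<open>g\<close> on the closed unit square, obtained by differentiating
  first in \<open>u2\<close> (giving \<open>g2\<close>) and then in \<open>u1\<close>. Derivatives are taken within \<open>{0..1}\<close>, so they
  are one-sided at the boundary.
\<close>

definition has_mixed_partial ::
  "(real \<Rightarrow> real \<Rightarrow> real) \<Rightarrow> (real \<Rightarrow> real \<Rightarrow> real) \<Rightarrow> bool" where
  "has_mixed_partial g h \<longleftrightarrow>
     (\<exists>g2. \<forall>u1\<in>{0..1}. \<forall>u2\<in>{0..1}.
        ((\<lambda>v. g u1 v) has_real_derivative g2 u1 u2) (at u2 within {0..1}) \<and>
        ((\<lambda>u. g2 u u2) has_real_derivative h u1 u2) (at u1 within {0..1}))"

definition satisfies_pde ::
  "real \<Rightarrow> real \<Rightarrow> real \<Rightarrow> (real \<Rightarrow> real \<Rightarrow> real) \<Rightarrow> bool" where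
  "satisfies_pde \<theta>1 \<theta>2 \<theta>3 g \<longleftrightarrow>
     (\<exists>d. \<forall>u1\<in>{0..1}.
        ((\<lambda>u. g u 1) has_real_derivative d u1) (at u1 within {0..1}) \<and>
        d u1 - \<theta>1 * g u1 1 = 0) \<and>
     (\<exists>d. \<forall>u2\<in>{0..1}.
        ((\<lambda>v. g 1 v) has_real_derivative d u2) (at u2 within {0..1}) \<and>
        d u2 - \<theta>2 * g 1 u2 = 0) \<and>
     (\<exists>h. has_mixed_partial g h \<and>
        (\<forall>u1\<in>{0..1}. \<forall>u2\<in>{0..1}. h u1 u2 - fBP \<theta>1 \<theta>2 \<theta>3 u1 u2 * g u1 u2 = 0))"

end

theory Submission
  imports Defs
begin

text \<open>
  That \<open>gBP\<close> is a pgf follows by building the law of \<open>(Y1 + Y3, Y2 + Y3)\<close> from independent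
  Poisson variables: independence factorises the expectation into three one-dimensional Poisson
  generating functions, and the exponents add up because
  \<open>u v - 1 = (u - 1) + (v - 1) + (u - 1) (v - 1)\<close>. That it solves the system is a differentiation.

  For uniqueness, let \<open>g\<close> be another solution. On the edges \<open>v = 1\<close> and \<open>u = 1\<close> the first two
  equations are ordinary differential equations with terminal value \<open>g 1 1 = 1\<close>, so \<open>g\<close> agrees
  with \<open>gBP\<close> there (\<open>exponential_ode_unique\<close>). The difference \<open>w\<close> then solves a linear Goursat
  problem: its mixed partial is \<open>f w\<close> with bounded \<open>f\<close>, and \<open>w\<close> vanishes on two adjacent edges. It
  is bounded because pgfs take values in \<open>[0, 1]\<close>. The Picard iteration for such a problem is a
  contraction in the exponentially weighted supremum norm, which forces \<open>w = 0\<close>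
  (\<open>goursat_zero\<close>).

  The Goursat problem is treated with a bounded \<open>w\<close> whose mixed partial exists pointwise and need not
  be integrable, so \<open>w\<close> is not represented as a double integral. Each integration of the Picard
  iteration is replaced by a comparison argument resting on the mean value theorem
  (\<open>bound_from_exponential_derivative_bound\<close>).
\<close>

section \<open>The generating function of the bivariate Poisson law\<close>

lemma nn_integral_poisson_power:
  fixes r x :: real
  assumes "r > 0" "x \<ge> 0"
  shows "(\<integral>\<^sup>+k. ennreal (x ^ k) \<partial>poisson_pmf r) = ennreal (exp (r * (x - 1)))"
proof -
  have s: "(\<lambda>k. r ^ k / fact k * exp (- r) * x ^ k) sums exp (r * (x - 1))"
  proof -
    have "(\<lambda>k. exp (- r) * ((r * x) ^ k /\<^sub>R fact k)) sums (exp (- r) * exp (r * x))"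
      by (intro sums_mult exp_converges)
    then show ?thesis
      by (simp add: power_mult_distrib field_simps exp_diff exp_minus)
  qed
  have "(\<integral>\<^sup>+k. ennreal (x ^ k) \<partial>poisson_pmf r)
      = (\<integral>\<^sup>+k. ennreal (r ^ k / fact k * exp (- r) * x ^ k) \<partial>count_space UNIV)"
    using assms by (simp add: nn_integral_measure_pmf ennreal_mult'[symmetric])
  also have "\<dots> = (\<Sum>k. ennreal (r ^ k / fact k * exp (- r) * x ^ k))"
    by (rule nn_integral_count_space_nat)
  also have "\<dots> = ennreal (exp (r * (x - 1)))"
    using assms s by (intro suminf_ennreal_eq) auto
  finally show ?thesis .
qed

text \<open>
  The expectation is computed as a nonnegative integral, so that no integrability has to be
  established before it is split over the three independent components.
\<close>

lemma is_pgf_gBP: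
  fixes \<theta>1 \<theta>2 \<theta>3 :: real
  assumes "(\<theta>1, \<theta>2, \<theta>3) \<in> Theta"
  shows "is_pgf (gBP \<theta>1 \<theta>2 \<theta>3)"
proof -
  have th: "\<theta>1 - \<theta>3 > 0" "\<theta>2 - \<theta>3 > 0" "\<theta>3 > 0"
    using assms by (auto simp: Theta_def)
  define p where "p = map_pmf (\<lambda>(y1, y2, y3). (y1 + y3, y2 + y3))
    (pair_pmf (poisson_pmf (\<theta>1 - \<theta>3)) (pair_pmf (poisson_pmf (\<theta>2 - \<theta>3)) (poisson_pmf \<theta>3)))"
  have "gBP \<theta>1 \<theta>2 \<theta>3 u v = pgf p u v" if "u \<in> {0..1}" "v \<in> {0..1}" for u v
  proof -
    have uv: "u \<ge> 0" "v \<ge> 0" using that by auto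
    have "(\<integral>\<^sup>+x. ennreal (case x of (x1, x2) \<Rightarrow> u ^ x1 * v ^ x2) \<partial>p)
      = (\<integral>\<^sup>+a. \<integral>\<^sup>+b. \<integral>\<^sup>+c. ennreal (u ^ a) * (ennreal (v ^ b) * ennreal ((u * v) ^ c))
           \<partial>poisson_pmf \<theta>3 \<partial>poisson_pmf (\<theta>2 - \<theta>3) \<partial>poisson_pmf (\<theta>1 - \<theta>3))"
      unfolding p_def using uv
      by (simp add: nn_integral_pair_pmf' power_add power_mult_distrib ennreal_mult'[symmetric]
          algebra_simps)
    also have "\<dots> = ennreal (exp ((\<theta>1 - \<theta>3) * (u - 1)))
        * (ennreal (exp ((\<theta>2 - \<theta>3) * (v - 1))) * ennreal (exp (\<theta>3 * (u * v - 1))))"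
      using th uv by (simp add: nn_integral_cmult nn_integral_multc nn_integral_poisson_power)
    also have "\<dots> = ennreal (gBP \<theta>1 \<theta>2 \<theta>3 u v)"
      by (simp add: gBP_def ennreal_mult'[symmetric] exp_add[symmetric] algebra_simps)
    finally have "(\<integral>\<^sup>+x. ennreal (case x of (x1, x2) \<Rightarrow> u ^ x1 * v ^ x2) \<partial>p)
      = ennreal (gBP \<theta>1 \<theta>2 \<theta>3 u v)" .
    then show ?thesis
      unfolding pgf_def using uv
      by (subst integral_eq_nn_integral) (auto simp: gBP_def)
  qed
  then show ?thesis unfolding is_pgf_def by blast
qed

section \<open>Probability generating functions on the unit square\<close>

lemma pgf_bounds:
  assumes "u \<in> {0..1}" "v \<in> {0..1}"
  shows "0 \<le> pgf p u v" "pgf p u v \<le> 1"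
proof -
  have le: "u ^ a * v ^ b \<le> 1" for a b
    using assms by (intro mult_le_one power_le_one) auto
  show "0 \<le> pgf p u v"
    unfolding pgf_def using assms by (intro integral_nonneg_AE) auto
  have "pgf p u v \<le> measure_pmf.expectation p (\<lambda>_. 1)"
    unfolding pgf_def using assms le
    by (intro integral_mono measure_pmf.integrable_const_bound[where B = 1]) auto
  then show "pgf p u v \<le> 1" by simp
qed

lemma pgf_one_one: "pgf p 1 1 = 1"
  by (simp add: pgf_def case_prod_unfold)

section \<open>The system of differential equations\<close>

lemma satisfies_pde_gBP: "satisfies_pde \<theta>1 \<theta>2 \<theta>3 (gBP \<theta>1 \<theta>2 \<theta>3)"
proof -
  let ?g = "gBP \<theta>1 \<theta>2 \<theta>3" and ?g2 = "\<lambda>u v. (\<theta>2 + \<theta>3 * (u - 1)) * gBP \<theta>1 \<theta>2 \<theta>3 u v"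
  have 1: "((\<lambda>u. ?g u 1) has_real_derivative \<theta>1 * ?g u 1) (at u within {0..1})" for u
    unfolding gBP_def by (auto intro!: derivative_eq_intros)
  have 2: "((\<lambda>v. ?g 1 v) has_real_derivative \<theta>2 * ?g 1 v) (at v within {0..1})" for v
    unfolding gBP_def by (auto intro!: derivative_eq_intros)
  have 3: "((\<lambda>v. ?g u v) has_real_derivative ?g2 u v) (at v within {0..1})" for u v
    unfolding gBP_def by (auto intro!: derivative_eq_intros)
  have 4: "((\<lambda>u. ?g2 u v) has_real_derivative fBP \<theta>1 \<theta>2 \<theta>3 u v * ?g u v) (at u within {0..1})"
    for u v
    unfolding gBP_def fBP_def by (auto intro!: derivative_eq_intros simp: algebra_simps)
  have "has_mixed_partial ?g (\<lambda>u v. fBP \<theta>1 \<theta>2 \<theta>3 u v * ?g u v)"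
    unfolding has_mixed_partial_def using 3 4 by (intro exI[of _ ?g2]) blast
  then show ?thesis
    unfolding satisfies_pde_def using 1 2
    by (intro conjI exI[of _ "\<lambda>u. \<theta>1 * ?g u 1"] exI[of _ "\<lambda>v. \<theta>2 * ?g 1 v"]
        exI[of _ "\<lambda>u v. fBP \<theta>1 \<theta>2 \<theta>3 u v * ?g u v"]) auto
qed

section \<open>Comparison for ordinary differential equations\<close>

text \<open>
  The integrating factor \<open>exp (- c (t - 1))\<close> turns a solution into a constant, which is read off
  at the right endpoint: that is where a pgf has a known value.
\<close>

lemma exponential_ode_unique:
  fixes y d :: "real \<Rightarrow> real"
  assumes der: "\<And>t. t \<in> {0..1} \<Longrightarrow> (y has_real_derivative d t) (at t within {0..1})"
    and ode: "\<And>t. t \<in> {0..1} \<Longrightarrow> d t = c * y t"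
    and "y 1 = 1" and t: "t \<in> {0..1}"
  shows "y t = exp (c * (t - 1))"
proof -
  have "((\<lambda>s. y s * exp (- (c * (s - 1)))) has_real_derivative 0) (at s within {0..1})"
    if "s \<in> {0..1}" for s
    using ode[OF that] by (auto intro!: derivative_eq_intros der that)
  then obtain k where k: "\<And>s. s \<in> {0..1} \<Longrightarrow> y s * exp (- (c * (s - 1))) = k"
    using has_field_derivative_zero_constant[of "{0..1::real}"
        "\<lambda>s. y s * exp (- (c * (s - 1)))"] by auto
  have "k = 1" using k[of 1] \<open>y 1 = 1\<close> by simp
  have "y t = y t * exp (- (c * (t - 1))) * exp (c * (t - 1))"
    by (simp add: mult.assoc mult_exp_exp)
  also have "\<dots> = exp (c * (t - 1))" using k[OF t] \<open>k = 1\<close> by simp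
  finally show ?thesis .
qed

text \<open>
  The bound on \<open>\<phi>'\<close> is minus the derivative of the claimed bound on \<open>\<phi>\<close>. Hence the latter minus
  \<open>\<plusminus>\<phi>\<close> is nonincreasing, and it is nonnegative at the right endpoint. Passing from \<open>\<phi>'\<close> to \<open>\<phi>\<close>
  thus gains a factor \<open>1 / L\<close> without any integration.
\<close>

lemma bound_from_exponential_derivative_bound:
  fixes \<phi> \<phi>' :: "real \<Rightarrow> real"
  assumes der: "\<And>s. s \<in> {0..1} \<Longrightarrow> (\<phi> has_real_derivative \<phi>' s) (at s within {0..1})"
    and bnd: "\<And>s. s \<in> {0..1} \<Longrightarrow> \<bar>\<phi>' s\<bar> \<le> L * A * exp (L * (1 - s))"
    and "\<phi> 1 = 0" "A \<ge> 0" and t: "t \<in> {0..1}"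
  shows "\<bar>\<phi> t\<bar> \<le> A * exp (L * (1 - t))"
proof -
  have "c * \<phi> t \<le> A * exp (L * (1 - t))" if "c = 1 \<or> c = - 1" for c
  proof -
    let ?F = "\<lambda>s. A * exp (L * (1 - s)) - c * \<phi> s"
    let ?F' = "\<lambda>s. - (L * A * exp (L * (1 - s))) - c * \<phi>' s"
    have "(?F has_real_derivative ?F' s) (at s within {t..1})" if "t \<le> s" "s \<le> 1" for s
      using t that
      by (auto intro!: derivative_eq_intros has_field_derivative_subset[OF der])
    then obtain s where s: "s \<in> {t..1}" "?F 1 - ?F t = ?F' s * (1 - t)"
      using mvt_very_simple[of t 1 ?F "\<lambda>s h. ?F' s * h"] t
      by (auto simp: has_field_derivative_def)
    have "?F' s \<le> 0"
      using bnd[of s] s(1) t that by (auto simp: abs_le_iff)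
    then have "?F 1 \<le> ?F t"
      using s(2) t mult_nonpos_nonneg[of "?F' s" "1 - t"] by auto
    then show ?thesis using assms(3,4) by simp
  qed
  from this[of 1] this[of "- 1"] show ?thesis by (simp add: abs_le_iff)
qed

section \<open>The Goursat problem on the unit square\<close>

text \<open>
  A bound \<open>C exp (L (1 - u)) exp (L (1 - v))\<close> on \<open>w\<close> yields \<open>K C\<close> times the same exponentials
  for the mixed partial; recovering \<open>w\<close> from it through the partial derivative in \<open>v\<close>
  gains \<open>1 / L\<close> twice. For \<open>L\<close> large this improves the constant by a fixed factor, and repetition
  drives it to zero.
\<close>

lemma goursat_zero:
  fixes w :: "real \<Rightarrow> real \<Rightarrow> real"
  assumes mixed: "has_mixed_partial w h"
    and h: "\<And>u v. u \<in> {0..1} \<Longrightarrow> v \<in> {0..1} \<Longrightarrow> \<bar>h u v\<bar> \<le> K * \<bar>w u v\<bar>"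
    and bounded: "\<And>u v. u \<in> {0..1} \<Longrightarrow> v \<in> {0..1} \<Longrightarrow> \<bar>w u v\<bar> \<le> B"
    and edge1: "\<And>u. u \<in> {0..1} \<Longrightarrow> w u 1 = 0"
    and edge2: "\<And>v. v \<in> {0..1} \<Longrightarrow> w 1 v = 0"
    and "K \<ge> 0" and uv: "u \<in> {0..1}" "v \<in> {0..1}"
  shows "w u v = 0"
proof -
  obtain w2 where
    d2: "\<And>u v. u \<in> {0..1} \<Longrightarrow> v \<in> {0..1} \<Longrightarrow>
      ((\<lambda>v. w u v) has_real_derivative w2 u v) (at v within {0..1})" and
    d12: "\<And>u v. u \<in> {0..1} \<Longrightarrow> v \<in> {0..1} \<Longrightarrow>
      ((\<lambda>u. w2 u v) has_real_derivative h u v) (at u within {0..1})"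
    using mixed unfolding has_mixed_partial_def by metis
  \<comment> \<open>Recovering \<open>w2\<close> from its \<open>u\<close>-derivative needs an edge value, which comes from
      differentiating \<open>w 1 v = 0\<close> along the edge; one-sided derivatives are unique
      as \<open>{0..1}\<close> has no isolated points.\<close>
  have w2_edge: "w2 1 v = 0" if v: "v \<in> {0..1}" for v
  proof -
    have "((\<lambda>v. w 1 v) has_real_derivative 0) (at v within {0..1})"
      unfolding has_field_derivative_def
      by (rule has_derivative_transform[OF v, of _ "\<lambda>_. 0"])
        (auto simp: edge2 intro!: derivative_eq_intros)
    moreover have "at v within {0..1} \<noteq> bot"
      using v by (simp add: trivial_limit_within)
    ultimately show ?thesis
      using has_field_derivative_unique[OF d2[of 1 v]] v by fastforce
  qed
  \<comment> \<open>With this \<open>L\<close> the gain \<open>K / L^2\<close> is at most \<open>1 / 4\<close>, since \<open>(K + 1)^2 - 4 K = (K - 1)^2\<close>.\<close>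
  define L where "L = K + 1"
  have L: "L > 0" "K \<le> L * L / 4"
    using \<open>K \<ge> 0\<close> zero_le_square[of "K - 1"] by (auto simp: L_def algebra_simps)
  have B: "B \<ge> 0" using bounded[OF uv] by linarith
  have iter: "\<bar>w u v\<bar> \<le> B / 4 ^ n * exp (L * (1 - u)) * exp (L * (1 - v))"
    if "u \<in> {0..1}" "v \<in> {0..1}" for u v n
    using that
  proof (induction n arbitrary: u v)
    case 0
    have "1 * 1 \<le> exp (L * (1 - u)) * exp (L * (1 - v))"
      using 0 L by (intro mult_mono) auto
    from mult_left_mono[OF this B] bounded[OF 0] show ?case by (simp add: mult.assoc)
  next
    case (Suc n)
    define A where "A = B / 4 ^ Suc n"
    have "A \<ge> 0" using B by (simp add: A_def)
    have w2_bound: "\<bar>w2 u v\<bar> \<le> L * A * exp (L * (1 - v)) * exp (L * (1 - u))"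
      if "u \<in> {0..1}" "v \<in> {0..1}" for u v
    proof (rule bound_from_exponential_derivative_bound[where \<phi> = "\<lambda>u. w2 u v" and \<phi>' = "\<lambda>u. h u v"])
      fix s :: real assume s: "s \<in> {0..1}"
      let ?E = "exp (L * (1 - s)) * exp (L * (1 - v))"
      have "\<bar>h s v\<bar> \<le> K * \<bar>w s v\<bar>" using h s that by blast
      also have "\<dots> \<le> (L * L / 4) * (B / 4 ^ n * ?E)"
        using Suc.IH[OF s that(2)] L(2) \<open>K \<ge> 0\<close> by (intro mult_mono) (auto simp: mult.assoc)
      also have "\<dots> = L * (L * A * exp (L * (1 - v))) * exp (L * (1 - s))"
        by (simp add: A_def)
      finally show "\<bar>h s v\<bar> \<le> L * (L * A * exp (L * (1 - v))) * exp (L * (1 - s))" .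
    qed (use d12 w2_edge L that \<open>A \<ge> 0\<close> in auto)
    have "\<bar>w u v\<bar> \<le> A * exp (L * (1 - u)) * exp (L * (1 - v))"
    proof (rule bound_from_exponential_derivative_bound[where \<phi> = "\<lambda>v. w u v" and \<phi>' = "\<lambda>v. w2 u v"])
      fix s :: real assume "s \<in> {0..1}"
      with w2_bound[of u s] Suc.prems
      show "\<bar>w2 u s\<bar> \<le> L * (A * exp (L * (1 - u))) * exp (L * (1 - s))"
        by (simp add: mult_ac)
    qed (use d2 edge1 Suc.prems \<open>A \<ge> 0\<close> in auto)
    then show ?case by (simp only: A_def)
  qed
  have "(\<lambda>n. (B * exp (L * (1 - u)) * exp (L * (1 - v))) * (1 / 4) ^ n) \<longlonglongrightarrow> 0"
    by (intro tendsto_mult_right_zero LIMSEQ_realpow_zero) auto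
  then have "\<bar>w u v\<bar> \<le> 0"
    using iter[OF uv] by (intro LIMSEQ_le_const) (auto simp: power_divide)
  then show ?thesis by simp
qed

lemma has_mixed_partial_diff:
  assumes "has_mixed_partial g h" "has_mixed_partial g' h'"
  shows "has_mixed_partial (\<lambda>u v. g u v - g' u v) (\<lambda>u v. h u v - h' u v)"
proof -
  obtain g2 g2' where
    "\<forall>u\<in>{0..1}. \<forall>v\<in>{0..1}. ((\<lambda>v. g u v) has_real_derivative g2 u v) (at v within {0..1}) \<and>
      ((\<lambda>u. g2 u v) has_real_derivative h u v) (at u within {0..1})"
    "\<forall>u\<in>{0..1}. \<forall>v\<in>{0..1}. ((\<lambda>v. g' u v) has_real_derivative g2' u v) (at v within {0..1}) \<and>
      ((\<lambda>u. g2' u v) has_real_derivative h' u v) (at u within {0..1})"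
    using assms unfolding has_mixed_partial_def by blast
  then show ?thesis
    unfolding has_mixed_partial_def
    by (intro exI[of _ "\<lambda>u v. g2 u v - g2' u v"] ballI conjI DERIV_diff) auto
qed

section \<open>Characterisation of the bivariate Poisson distribution\<close>

theorem proposition1:
  fixes \<theta>1 \<theta>2 \<theta>3 :: real
  assumes "(\<theta>1, \<theta>2, \<theta>3) \<in> Theta"
  shows "is_pgf (gBP \<theta>1 \<theta>2 \<theta>3) \<and> satisfies_pde \<theta>1 \<theta>2 \<theta>3 (gBP \<theta>1 \<theta>2 \<theta>3) \<and>
    (\<forall>g. is_pgf g \<and> satisfies_pde \<theta>1 \<theta>2 \<theta>3 g \<longrightarrow>
      (\<forall>u1\<in>{0..1}. \<forall>u2\<in>{0..1}. g u1 u2 = gBP \<theta>1 \<theta>2 \<theta>3 u1 u2))"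
proof (intro conjI allI impI ballI)
  show "is_pgf (gBP \<theta>1 \<theta>2 \<theta>3)" by (rule is_pgf_gBP[OF assms])
  show "satisfies_pde \<theta>1 \<theta>2 \<theta>3 (gBP \<theta>1 \<theta>2 \<theta>3)" by (rule satisfies_pde_gBP)
next
  fix g :: "real \<Rightarrow> real \<Rightarrow> real" and u1 u2 :: real
  assume g: "is_pgf g \<and> satisfies_pde \<theta>1 \<theta>2 \<theta>3 g" and u: "u1 \<in> {0..1}" "u2 \<in> {0..1}"
  have th: "\<theta>1 > \<theta>3" "\<theta>2 > \<theta>3" "\<theta>3 > 0" using assms by (auto simp: Theta_def)
  let ?G = "gBP \<theta>1 \<theta>2 \<theta>3" and ?f = "fBP \<theta>1 \<theta>2 \<theta>3"
  have range: "0 \<le> q u v \<and> q u v \<le> 1" if "is_pgf q" "u \<in> {0..1}" "v \<in> {0..1}" for q u v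
    using that pgf_bounds unfolding is_pgf_def by metis
  have "g 1 1 = 1" using g pgf_one_one unfolding is_pgf_def by force
  have sys: "satisfies_pde \<theta>1 \<theta>2 \<theta>3 g" using g by blast
  obtain d1 where d1:
    "\<And>u. u \<in> {0..1} \<Longrightarrow> ((\<lambda>u. g u 1) has_real_derivative d1 u) (at u within {0..1})"
    "\<And>u. u \<in> {0..1} \<Longrightarrow> d1 u = \<theta>1 * g u 1"
    using sys unfolding satisfies_pde_def right_minus_eq by metis
  obtain d2 where d2:
    "\<And>v. v \<in> {0..1} \<Longrightarrow> ((\<lambda>v. g 1 v) has_real_derivative d2 v) (at v within {0..1})"
    "\<And>v. v \<in> {0..1} \<Longrightarrow> d2 v = \<theta>2 * g 1 v"
    using sys unfolding satisfies_pde_def right_minus_eq by metis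
  have mixed_eq: "\<exists>h. has_mixed_partial q h \<and> (\<forall>u\<in>{0..1}. \<forall>v\<in>{0..1}. h u v = ?f u v * q u v)"
    if "satisfies_pde \<theta>1 \<theta>2 \<theta>3 q" for q
    using that unfolding satisfies_pde_def right_minus_eq by (elim conjE)
  obtain h where mg: "has_mixed_partial g h" and
    h: "\<And>u v. u \<in> {0..1} \<Longrightarrow> v \<in> {0..1} \<Longrightarrow> h u v = ?f u v * g u v"
    using mixed_eq[OF sys] by blast
  obtain H where mG: "has_mixed_partial ?G H" and
    H: "\<And>u v. u \<in> {0..1} \<Longrightarrow> v \<in> {0..1} \<Longrightarrow> H u v = ?f u v * ?G u v"
    using mixed_eq[OF satisfies_pde_gBP] by blast
  define w where "w = (\<lambda>u v. g u v - ?G u v)"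
  have "w u1 u2 = 0"
  proof (rule goursat_zero[where w = w and h = "\<lambda>u v. h u v - H u v"
        and K = "\<theta>3 + \<theta>2 * \<theta>1" and B = 1])
    show "has_mixed_partial w (\<lambda>u v. h u v - H u v)"
      unfolding w_def by (rule has_mixed_partial_diff[OF mg mG])
  next
    fix u v :: real assume uv: "u \<in> {0..1}" "v \<in> {0..1}"
    \<comment> \<open>As \<open>\<theta>3 < \<theta>1\<close> and \<open>\<theta>3 < \<theta>2\<close>, both factors in \<open>f\<close> are nonnegative, so \<open>\<bar>f\<bar>\<close> is largest
        at \<open>(1, 1)\<close>.\<close>
    have "0 \<le> \<theta>3 * u" "0 \<le> \<theta>3 * v" "\<theta>3 * u \<le> \<theta>3" "\<theta>3 * v \<le> \<theta>3"
      using th uv by (auto simp: mult_left_le)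
    then have a: "0 \<le> \<theta>2 + \<theta>3 * (u - 1)" "\<theta>2 + \<theta>3 * (u - 1) \<le> \<theta>2"
      "0 \<le> \<theta>1 + \<theta>3 * (v - 1)" "\<theta>1 + \<theta>3 * (v - 1) \<le> \<theta>1"
      using th unfolding right_diff_distrib by linarith+
    have "\<bar>?f u v\<bar> \<le> \<theta>3 + \<theta>2 * \<theta>1"
      using a th mult_mono[OF a(2,4)] by (simp add: fBP_def)
    moreover have "h u v - H u v = ?f u v * w u v"
      using h[OF uv] H[OF uv] by (simp add: w_def algebra_simps)
    ultimately show "\<bar>h u v - H u v\<bar> \<le> (\<theta>3 + \<theta>2 * \<theta>1) * \<bar>w u v\<bar>"
      by (simp add: abs_mult mult_right_mono)
    show "\<bar>w u v\<bar> \<le> 1"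
      using range[OF _ uv, of g] range[OF _ uv, of ?G] g is_pgf_gBP[OF assms]
      by (auto simp: w_def abs_le_iff)
  next
    fix u :: real assume "u \<in> {0..1}"
    then show "w u 1 = 0"
      using exponential_ode_unique[OF d1 \<open>g 1 1 = 1\<close>] by (simp add: w_def gBP_def)
  next
    fix v :: real assume "v \<in> {0..1}"
    then show "w 1 v = 0"
      using exponential_ode_unique[OF d2 \<open>g 1 1 = 1\<close>] by (simp add: w_def gBP_def)
  qed (use th u in auto)
  then show "g u1 u2 = ?G u1 u2" by (simp add: w_def)
qed

end
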